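(* Let $\alpha\in(0,1)$ and assume that $F^{\mathbb Q}(y)=1-g(S(y))$ with $g(y)=\frac{y}{\alpha}\chi_{[0,\alpha)}(y)+\chi_{[\alpha,1]}(y)$, i.e. the premium is calculated by $\mathrm{ES}$ (the premium for $I\in\mathcal C$ is $(1+\theta)\mathbb E^{\mathbb Q}[I(Y)]=(1+\theta)\mathrm{ES}_\alpha(I(Y))$). Then the optimal form of the indemnity function for the insurer's mean-variance problem is $$I^*(t,y)=y\wedge a_t^*+(y-b_t^* )_+.$$ Moreover, with $I^*_{a,b}(y)=y\wedge a+(y-b)_+$, the optimal parameters satisfy $$(a_t^*,b_t^* )\in\operatorname*{arg\,min}_{a,b}\Big\{(1+\theta)\mathrm{ES}_\alpha(I^*_{a,b}(Y))+\mathbb E[Y-I^*_{a,b}(Y)]+\frac{\gamma e^{r(T-t)}}{2}\mathbb E[(Y-I^*_{a,b}(Y))^2]\Big\}$$ subject to $0\le a\le \mathrm{VaR}_\alpha(Y)$ and $\mathrm{VaR}_\alpha(Y)\le b\le\max\big\{a+\frac{1+\theta}{\alpha\gamma e^{r(T-t)}},\ \mathrm{VaR}_\alpha(Y)\big\}$. That is, for every $t\in[0,T]$, with such parameters, $I^*(t,\cdot)$ attains $\inf_{I\in\mathcal C}H(t,I)$.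
   Context: Constants: $T>0$, $r>0$, $\gamma>0$, $\theta\ge 0$. $Y$ is a positive random variable (claim size) considered under two probability measures $\mathbb P$ (insurer) and $\mathbb Q$ (reinsurer), with finite first and second moments under both. $F$ and $F^{\mathbb Q}$ are its distribution functions under $\mathbb P$ and $\mathbb Q$; $S=1-F$; $F$ has a density and is non-differentiable at only finitely many points. $\mathbb E$ is expectation under $\mathbb P$, $\mathbb E^{\mathbb Q}$ under $\mathbb Q$. $x_+=\max\{x,0\}$, $x\wedge y=\min\{x,y\}$, $\chi$ denotes an indicator function. For a nonnegative random variable $Z$ and level $s\in(0,1)$: $\mathrm{VaR}_s(Z)=\inf\{z\in\mathbb R_+:\mathbb P(Z\le z)\ge 1-s\}$ and $\mathrm{ES}_\alpha(Z)=\frac1\alpha\int_0^\alpha \mathrm{VaR}_s(Z)\,ds$. $\mathcal C:=\{f:\mathbb R_+\to\mathbb R_+ \mid f(0)=0,\ 0\le f(y)-f(x)\le y-x\ \text{for all } x\le y\}$. $H(t,I):=(1+\theta)\mathbb E^{\mathbb Q}[I(Y)]+\mathbb E[Y-I(Y)]+\dfrac{\gamma e^{r(T-t)}}{2}\mathbb E[(Y-I(Y))^2]$ for $I\in\mathcal C$. The insurer's problem: maximise $\mathbb E_{t,x}[X(T)]-\frac{\gamma}{2}\mathrm{Var}_{t,x}[X(T)]$ over reinsurance strategies $\{I(t,\cdot)\}$ with $I(t,\cdot)\in\mathcal C$, where $X$ is a Cramér–Lundberg surplus with claims $Y_i$ (intensity 1), interest rate $r$, and reinsurance premium rate $(1+\theta)\mathbb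 E^{\mathbb Q}[I(t,Y)]$. It is solved in the time-consistent (equilibrium) sense; via the extended HJB system, the optimal indemnity function means a family $I^*(t,\cdot)\in\mathcal C$ attaining $\inf_{I\in\mathcal C}H(t,I)$ for every $t\in[0,T]$. *)

theory Defs
  imports "HOL-Probability.Probability"
begin

text \<open>
  Here \<open>s\<close> is the upper tail probability, so \<open>VaR M s Z\<close> is the lower \<open>(1 - s)\<close>-quantile.
  It is meaningful for nonnegative \<open>Z\<close> and \<open>0 < s < 1\<close>, where the set is nonempty; the value
  at \<open>s = 0\<close> is arbitrary if \<open>Z\<close> is unbounded, and the integral below does not depend on it.
\<close>

definition VaR :: "'a measure \<Rightarrow> real \<Rightarrow> ('a \<Rightarrow> real) \<Rightarrow> real" where
  "VaR M s Z = Inf {z. 0 \<le> z \<and> measure M {\<omega> \<in> space M. Z \<omega> \<le> z} \<ge> 1 - s}"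

definition ES :: "'a measure \<Rightarrow> real \<Rightarrow> ('a \<Rightarrow> real) \<Rightarrow> real" where
  "ES M \<alpha> Z = (1 / \<alpha>) * (LBINT s=0..\<alpha>. VaR M s Z)"

definition ES_distortion :: "real \<Rightarrow> real \<Rightarrow> real" where
  "ES_distortion \<alpha> y = y / \<alpha> * indicator {0..<\<alpha>} y + indicator {\<alpha>..1} y"

text \<open>
  Functions on the nonnegative half-line are represented by functions on \<open>real\<close> that are
  unconstrained at negative arguments; they are only ever evaluated at values of a positive
  random variable.
\<close>

definition indemnities :: "(real \<Rightarrow> real) set" where
  "indemnities = {f. f 0 = 0 \<and> (\<forall>x\<ge>0. 0 \<le> f x) \<and>
     (\<forall>x y. 0 \<le> x \<and> x \<le> y \<longrightarrow> 0 \<le> f y - f x \<and> f y - f x \<le> y - x)}"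

text \<open>
  \<open>P\<close> is the insurer's measure and \<open>Q\<close> the reinsurer's.
\<close>

definition hjb_objective ::
  "'a measure \<Rightarrow> 'a measure \<Rightarrow> ('a \<Rightarrow> real) \<Rightarrow> real \<Rightarrow> real \<Rightarrow> real \<Rightarrow> real \<Rightarrow> real
    \<Rightarrow> (real \<Rightarrow> real) \<Rightarrow> real" where
  "hjb_objective P Q Y \<theta> \<gamma> r T t I =
     (1 + \<theta>) * (\<integral>\<omega>. I (Y \<omega>) \<partial>Q) + (\<integral>\<omega>. Y \<omega> - I (Y \<omega>) \<partial>P)
       + \<gamma> * exp (r * (T - t)) / 2 * (\<integral>\<omega>. (Y \<omega> - I (Y \<omega>))\<^sup>2 \<partial>P)"

text \<open>
  By the extended HJB system, a time-consistent equilibrium indemnity of the mean-variance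
  problem is a pointwise-in-time minimiser of \<open>hjb_objective\<close>.
\<close>

definition optimal_indemnity ::
  "'a measure \<Rightarrow> 'a measure \<Rightarrow> ('a \<Rightarrow> real) \<Rightarrow> real \<Rightarrow> real \<Rightarrow> real \<Rightarrow> real
    \<Rightarrow> (real \<Rightarrow> real \<Rightarrow> real) \<Rightarrow> bool" where
  "optimal_indemnity P Q Y \<theta> \<gamma> r T Istar \<longleftrightarrow>
     (\<forall>t\<in>{0..T}. is_arg_min (hjb_objective P Q Y \<theta> \<gamma> r T t) (\<lambda>I. I \<in> indemnities) (Istar t))"

definition two_layer :: "real \<Rightarrow> real \<Rightarrow> real \<Rightarrow> real" where
  "two_layer a b y = min y a + max (y - b) 0"

definition ES_objective ::
  "'a measure \<Rightarrow> ('a \<Rightarrow> real) \<Rightarrow> real \<Rightarrow> real \<Rightarrow> real \<Rightarrow> real \<Rightarrow> real \<Rightarrow> real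
    \<Rightarrow> (real \<Rightarrow> real) \<Rightarrow> real" where
  "ES_objective P Y \<alpha> \<theta> \<gamma> r T t I =
     (1 + \<theta>) * ES P \<alpha> (\<lambda>\<omega>. I (Y \<omega>)) + (\<integral>\<omega>. Y \<omega> - I (Y \<omega>) \<partial>P)
       + \<gamma> * exp (r * (T - t)) / 2 * (\<integral>\<omega>. (Y \<omega> - I (Y \<omega>))\<^sup>2 \<partial>P)"

definition optimal_layers ::
  "'a measure \<Rightarrow> ('a \<Rightarrow> real) \<Rightarrow> real \<Rightarrow> real \<Rightarrow> real \<Rightarrow> real \<Rightarrow> real \<Rightarrow> real
    \<Rightarrow> real \<times> real \<Rightarrow> bool" where
  "optimal_layers P Y \<alpha> \<theta> \<gamma> r T t =
     is_arg_min
       (\<lambda>(a, b). ES_objective P Y \<alpha> \<theta> \<gamma> r T t (two_layer a b))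
       (\<lambda>(a, b). 0 \<le> a \<and> a \<le> VaR P \<alpha> Y \<and> VaR P \<alpha> Y \<le> b \<and>
          b \<le> max (a + (1 + \<theta>) / (\<alpha> * \<gamma> * exp (r * (T - t)))) (VaR P \<alpha> Y))"

end

theory Submission
  imports Defs
begin

text \<open>
  The distorted law of the claim is its conditional law given that it exceeds its quantile
  \<open>v = VaR P \<alpha> Y\<close>: under \<open>Q\<close> the claim exceeds \<open>v\<close> almost surely, and tail
  probabilities beyond \<open>v\<close> are those under \<open>P\<close> times \<open>1 / \<alpha>\<close>
  (\<open>expectation_distorted_eq_tail\<close>). With \<open>\<rho> = (1 + \<theta>) / \<alpha>\<close> and
  \<open>K = \<gamma> * exp (r * (T - t))\<close>, the objective is therefore a single expectation under \<open>P\<close>,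
  \<^item> of \<open>R + K / 2 * R\<^sup>2\<close> where the claim \<open>y\<close> is at most \<open>v\<close>,
  \<^item> of \<open>\<rho> * y + (1 - \<rho>) * R + K / 2 * R\<^sup>2\<close> where it is larger,

  in which \<open>R = y - I y\<close> is the retained loss. The functional is local in \<open>y\<close>, and the two
  regions interact only through the slope constraints on \<open>R\<close>. Once the value of \<open>R\<close> at \<open>v\<close> is
  fixed, both regions can be optimised pointwise and simultaneously, and the minimiser is a
  two-layer indemnity (\<open>two_layer_pointwise_optimal\<close>). Hence every indemnity is matched or beaten
  by one with layers in the constraint set, and minimising over that set solves the full problem
  (\<open>two_layer_beats_indemnity\<close>). A minimiser over layers exists because the constraint set is
  compact and the objective is continuous on it, by dominated convergence.

  The premium identity rests on the fact that the quantile at a uniform level in \<open>(0, \<alpha>)\<close> has the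
  distorted law (\<open>cdf_VaR_uniform_level\<close>), and that passing to an indemnity, a continuous
  nondecreasing function of the claim, commutes with the distortion
  (\<open>cdf_indemnity_distorted\<close>).
\<close>

section \<open>Laws determined by the distortion\<close>

lemma ES_distortion_eq_min:
  assumes "0 < \<alpha>" "\<alpha> < 1" "0 \<le> s" "s \<le> 1"
  shows "ES_distortion \<alpha> s = min (s / \<alpha>) 1"
  using assms by (auto simp: ES_distortion_def indicator_def min_def field_simps)

lemma cdf_distr_eq:
  assumes "Z \<in> borel_measurable M"
  shows "cdf (distr M borel Z) z = measure M {\<omega> \<in> space M. Z \<omega> \<le> z}"
  using assms by (simp add: cdf_def measure_distr vimage_def Int_def conj_commute)

lemma real_distribution_distr_borel:
  assumes "prob_space M" "Z \<in> borel_measurable M"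
  shows "real_distribution (distr M borel Z)"
  using assms by (simp add: real_distribution_def real_distribution_axioms_def
      prob_space.prob_space_distr)

lemma cdf_distr_eq_0_of_nonneg:
  assumes "Z \<in> borel_measurable M" "\<And>\<omega>. \<omega> \<in> space M \<Longrightarrow> 0 \<le> Z \<omega>" "z < 0"
  shows "cdf (distr M borel Z) z = 0"
proof -
  have "{\<omega> \<in> space M. Z \<omega> \<le> z} = {}"
    using assms by force
  then show ?thesis
    using assms(1) by (simp only: cdf_distr_eq measure_empty)
qed

lemma cdf_distr_in_01:
  assumes "prob_space M" "Z \<in> borel_measurable M"
  shows "0 \<le> cdf (distr M borel Z) z" "cdf (distr M borel Z) z \<le> 1"
  using assms prob_space.prob_le_1[OF assms(1)] by (simp_all add: cdf_distr_eq)

lemma VaR_candidates_nonempty: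
  assumes "prob_space M" "Z \<in> borel_measurable M" "0 < s"
  shows "{z. 0 \<le> z \<and> 1 - s \<le> cdf (distr M borel Z) z} \<noteq> {}"
proof -
  interpret D: real_distribution "distr M borel Z"
    using assms by (intro real_distribution_distr_borel)
  have "eventually (\<lambda>z. 1 - s < cdf (distr M borel Z) z) at_top"
    using order_tendstoD(1)[OF D.cdf_lim_at_top_prob] assms by simp
  then have "eventually (\<lambda>z. 0 \<le> z \<and> 1 - s < cdf (distr M borel Z) z) at_top"
    using eventually_ge_at_top[of 0] by eventually_elim auto
  then obtain z where "0 \<le> z" "1 - s < cdf (distr M borel Z) z"
    using eventually_happens'[OF trivial_limit_at_top_linorder] by blast
  then show "{z. 0 \<le> z \<and> 1 - s \<le> cdf (distr M borel Z) z} \<noteq> {}"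
    by force
qed

lemma VaR_nonneg:
  assumes "prob_space M" "Z \<in> borel_measurable M" "0 < s"
  shows "0 \<le> VaR M s Z"
  unfolding VaR_def cdf_distr_eq[OF assms(2), symmetric]
  by (rule cInf_greatest[OF VaR_candidates_nonempty[OF assms]]) auto

text \<open>
  \<open>VaR\<close> is a generalised inverse of the distribution function. The direction from
  \<open>VaR \<le> z\<close> to the probability bound needs the infimum to be attained, which is
  right-continuity of the distribution function.
\<close>

lemma VaR_le_iff:
  assumes "prob_space M" "Z \<in> borel_measurable M" "0 < s" "0 \<le> z"
  shows "VaR M s Z \<le> z \<longleftrightarrow> 1 - s \<le> cdf (distr M borel Z) z"
proof -
  interpret D: real_distribution "distr M borel Z"
    using assms by (intro real_distribution_distr_borel)
  let ?F = "cdf (distr M borel Z)"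
  let ?A = "{z. 0 \<le> z \<and> 1 - s \<le> ?F z}"
  have V: "VaR M s Z = Inf ?A"
    unfolding VaR_def cdf_distr_eq[OF assms(2), symmetric] by simp
  have bdd: "bdd_below ?A"
    by (rule bdd_belowI[of _ 0]) auto
  show ?thesis
  proof
    assume le: "VaR M s Z \<le> z"
    have above: "1 - s \<le> ?F w" if "z < w" for w
    proof -
      have "Inf ?A < w"
        using le that V by simp
      then obtain u where "u \<in> ?A" "u < w"
        using cInf_lessD VaR_candidates_nonempty[OF assms(1-3)] by metis
      then show ?thesis
        using D.cdf_nondecreasing[of u w] by auto
    qed
    have "(?F \<longlongrightarrow> ?F z) (at_right z)"
      using D.cdf_is_right_cont by (simp add: continuous_within)
    moreover have "eventually (\<lambda>w. 1 - s \<le> ?F w) (at_right z)"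
      using above by (auto simp: eventually_at_right_field intro: exI[of _ "z + 1"])
    ultimately show "1 - s \<le> ?F z"
      by (intro tendsto_lowerbound) auto
  next
    assume "1 - s \<le> ?F z"
    then show "VaR M s Z \<le> z"
      unfolding V using assms(4) by (intro cInf_lower[OF _ bdd]) auto
  qed
qed

text \<open>
  Left of its quantile the distribution function is at most \<open>1 - s\<close>; without an atom there, this
  bound passes to the limit and meets the lower bound from \<open>VaR_le_iff\<close>.
\<close>

lemma cdf_VaR_eq:
  assumes "prob_space M" "Z \<in> borel_measurable M" "\<And>\<omega>. \<omega> \<in> space M \<Longrightarrow> 0 \<le> Z \<omega>"
    and "0 < s" "s \<le> 1" "isCont (cdf (distr M borel Z)) (VaR M s Z)"
  shows "cdf (distr M borel Z) (VaR M s Z) = 1 - s"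
proof (rule antisym)
  let ?F = "cdf (distr M borel Z)"
  have below: "?F w \<le> 1 - s" if "w < VaR M s Z" for w
  proof (cases "0 \<le> w")
    case True
    then show ?thesis
      using VaR_le_iff[OF assms(1,2,4), of w] that by auto
  next
    case False
    then show ?thesis
      using cdf_distr_eq_0_of_nonneg[OF assms(2,3), of w] assms(5) by auto
  qed
  have "(?F \<longlongrightarrow> ?F (VaR M s Z)) (at_left (VaR M s Z))"
    using assms(6) by (simp add: isCont_def filterlim_at_split)
  moreover have "eventually (\<lambda>w. ?F w \<le> 1 - s) (at_left (VaR M s Z))"
    using below by (auto simp: eventually_at_left_field intro: exI[of _ "VaR M s Z - 1"])
  ultimately show "?F (VaR M s Z) \<le> 1 - s"
    by (intro tendsto_upperbound) auto
  show "1 - s \<le> ?F (VaR M s Z)"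
    using VaR_le_iff[OF assms(1,2,4) VaR_nonneg[OF assms(1,2,4)]] by simp
qed

text \<open>
  The density of \<open>uniform_measure\<close> is a quotient of extended nonnegative reals; when the mass of
  the set is finite and positive it is a real function, and the Bochner integral can be
  transferred along it.
\<close>

lemma integral_uniform_measure:
  fixes f :: "'a \<Rightarrow> real"
  assumes "A \<in> sets M" "f \<in> borel_measurable M" "emeasure M A = ennreal c" "0 < c"
  shows "(\<integral>x. f x \<partial>uniform_measure M A) = 1 / c * (\<integral>x. indicator A x * f x \<partial>M)"
proof -
  have "uniform_measure M A = density M (\<lambda>x. ennreal (indicator A x / c))"
    unfolding uniform_measure_def assms(3) using assms(4)
    by (intro arg_cong[of _ _ "density M"] ext)
       (simp add: divide_ennreal[symmetric] indicator_def flip: ennreal_1)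
  moreover have "(\<integral>x. f x \<partial>density M (\<lambda>x. ennreal (indicator A x / c)))
      = (\<integral>x. (indicator A x / c) *\<^sub>R f x \<partial>M)"
    using assms by (intro integral_density) auto
  ultimately show ?thesis
    by simp
qed

text \<open>
  Inverse transform sampling: a level drawn uniformly from \<open>(0, \<alpha>)\<close>, pushed through the
  quantile function, has the distorted law.
\<close>

lemma cdf_VaR_uniform_level:
  fixes M :: "'a measure"
  defines "U \<alpha> \<equiv> uniform_measure lborel {0<..<\<alpha>}"
  assumes M: "prob_space M" and Z: "Z \<in> borel_measurable M" "\<And>\<omega>. \<omega> \<in> space M \<Longrightarrow> 0 \<le> Z \<omega>"
    and \<alpha>: "0 < \<alpha>" "\<alpha> < 1"
  defines "q \<equiv> \<lambda>s. if s \<in> {0<..<\<alpha>} then VaR M s Z else 0"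
  shows "q \<in> borel_measurable lborel"
    and "cdf (distr (U \<alpha>) borel q) z = 1 - ES_distortion \<alpha> (1 - cdf (distr M borel Z) z)"
proof -
  let ?F = "cdf (distr M borel Z)"
  have q_iff: "q s \<le> z \<longleftrightarrow> 1 - ?F z \<le> s" if "0 < s" "s < \<alpha>" "0 \<le> z" for s z
    using VaR_le_iff[OF M Z(1) that(1,3)] that by (auto simp: q_def)
  have q_nonneg: "0 \<le> q s" for s
    using VaR_nonneg[OF M Z(1)] by (auto simp: q_def)
  show meas: "q \<in> borel_measurable lborel"
  proof -
    have "{s. q s \<le> z} \<in> sets borel" for z
    proof (cases "0 \<le> z")
      case True
      then have "{s. q s \<le> z} = ({0<..<\<alpha>} \<inter> {1 - ?F z..}) \<union> - {0<..<\<alpha>}"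
        using q_iff[of _ z] by (auto simp: q_def)
      then show ?thesis
        by simp
    next
      case False
      then have "{s. q s \<le> z} = {}"
        using q_nonneg by (auto simp: not_le intro: less_le_trans)
      then show ?thesis
        by simp
    qed
    then show ?thesis
      by (simp add: borel_measurable_iff_le)
  qed
  then have meas_U: "q \<in> borel_measurable (U \<alpha>)"
    by (simp add: U_def)
  note F01 = cdf_distr_in_01[OF M Z(1), of z]
  show "cdf (distr (U \<alpha>) borel q) z = 1 - ES_distortion \<alpha> (1 - ?F z)"
  proof (cases "0 \<le> z")
    case True
    have set_eq: "{s. q s \<le> z} \<inter> {0<..<\<alpha>} = {0<..<\<alpha>} \<inter> {1 - ?F z..}"
      using q_iff[OF _ _ True] by auto
    have "measure lborel ({0<..<\<alpha>} \<inter> {1 - ?F z..}) = \<alpha> - min (1 - ?F z) \<alpha>"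
    proof (cases "1 - ?F z > 0")
      case True
      then have "{0<..<\<alpha>} \<inter> {1 - ?F z..} = {1 - ?F z..<\<alpha>}"
        by auto
      then show ?thesis
        by (simp add: min_def)
    next
      case False
      then have "{0<..<\<alpha>} \<inter> {1 - ?F z..} = {0<..<\<alpha>}" "1 - ?F z = 0"
        using F01 by auto
      then show ?thesis
        using \<alpha> by simp
    qed
    then have *: "measure lborel ({0<..<\<alpha>} \<inter> {s. q s \<le> z}) = \<alpha> - min (1 - ?F z) \<alpha>"
      using set_eq by (simp add: Int_commute)
    have qs: "{s. q s \<le> z} \<in> sets lborel"
      using measurable_sets[OF meas, of "{..z}"] by (simp add: vimage_def)
    have "cdf (distr (U \<alpha>) borel q) z = measure (U \<alpha>) {s. q s \<le> z}"
      using cdf_distr_eq[OF meas_U, of z] by (simp add: U_def)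
    also have "\<dots> = (\<alpha> - min (1 - ?F z) \<alpha>) / \<alpha>"
      unfolding U_def using * \<alpha> qs by (subst measure_uniform_measure) auto
    also have "\<dots> = 1 - min ((1 - ?F z) / \<alpha>) 1"
      using \<alpha> by (auto simp: min_def field_simps)
    finally show ?thesis
      using F01 \<alpha> by (simp add: ES_distortion_eq_min)
  next
    case False
    then show ?thesis
      using cdf_distr_eq_0_of_nonneg[OF Z, of z] cdf_distr_eq_0_of_nonneg[OF meas_U q_nonneg, of z] \<alpha>
      by (simp add: ES_distortion_eq_min)
  qed
qed

text \<open>
  The two sides are means of variables with the same distribution function: \<open>Z\<close> under the
  distorted measure, and the quantile at a uniform level in \<open>(0, \<alpha>)\<close>.
\<close>

lemma expectation_distorted_eq_ES:
  assumes M: "prob_space M" and Z: "Z \<in> borel_measurable M" "\<And>\<omega>. \<omega> \<in> space M \<Longrightarrow> 0 \<le> Z \<omega>"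
    and N: "prob_space N" "Z' \<in> borel_measurable N"
    and \<alpha>: "0 < \<alpha>" "\<alpha> < 1"
    and cdf: "\<And>z. cdf (distr N borel Z') z = 1 - ES_distortion \<alpha> (1 - cdf (distr M borel Z) z)"
  shows "(\<integral>\<omega>. Z' \<omega> \<partial>N) = ES M \<alpha> Z"
proof -
  define q where "q = (\<lambda>s. if s \<in> {0<..<\<alpha>} then VaR M s Z else 0)"
  let ?U = "uniform_measure lborel {0<..<\<alpha>}"
  note q = cdf_VaR_uniform_level[OF M Z \<alpha>, folded q_def]
  have U: "prob_space ?U"
    using \<alpha> by (intro prob_space_uniform_measure) auto
  have qU: "q \<in> borel_measurable ?U"
    using q(1) by simp
  have "distr N borel Z' = distr ?U borel q"
    using cdf q(2) by (intro cdf_unique real_distribution_distr_borel N U qU) auto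
  then have "(\<integral>\<omega>. Z' \<omega> \<partial>N) = (\<integral>s. q s \<partial>?U)"
    using integral_distr[OF N(2), of "\<lambda>x. x"] integral_distr[OF qU, of "\<lambda>x. x"] by simp
  also have "\<dots> = 1 / \<alpha> * (\<integral>s. indicator {0<..<\<alpha>} s * q s \<partial>lborel)"
    using q(1) \<alpha> by (intro integral_uniform_measure) auto
  also have "(\<integral>s. indicator {0<..<\<alpha>} s * q s \<partial>lborel) = (LBINT s=0..\<alpha>. VaR M s Z)"
    using \<alpha> by (subst interval_integral_Ioo)
      (auto simp: set_lebesgue_integral_def q_def indicator_def zero_ereal_def
        intro!: Bochner_Integration.integral_cong)
  finally show ?thesis
    by (simp add: ES_def)
qed

section \<open>Indemnities\<close>

lemma indemnitiesD:
  assumes "I \<in> indemnities"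
  shows "I 0 = 0" "\<And>y. 0 \<le> y \<Longrightarrow> 0 \<le> I y" "\<And>y. 0 \<le> y \<Longrightarrow> I y \<le> y"
    "\<And>x y. 0 \<le> x \<Longrightarrow> x \<le> y \<Longrightarrow> I x \<le> I y"
    "\<And>x y. 0 \<le> x \<Longrightarrow> x \<le> y \<Longrightarrow> I y - I x \<le> y - x"
proof -
  have *: "0 \<le> I y - I x" "I y - I x \<le> y - x" if "0 \<le> x" "x \<le> y" for x y
    using assms that by (auto simp: indemnities_def)
  show "I 0 = 0"
    using assms by (simp add: indemnities_def)
  then show "0 \<le> I y" "I y \<le> y" if "0 \<le> y" for y
    using *[of 0 y] that by auto
  show "I x \<le> I y" "I y - I x \<le> y - x" if "0 \<le> x" "x \<le> y" for x y
    using *[OF that] by auto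
qed

text \<open>
  Truncating the argument at zero gives a version of an indemnity that is regular on the whole
  line and has the same values at nonnegative claims.
\<close>

lemma continuous_on_indemnity_max:
  assumes "I \<in> indemnities"
  shows "continuous_on UNIV (\<lambda>y. I (max 0 y))"
proof -
  have mono: "\<bar>I (max 0 x) - I (max 0 y)\<bar> \<le> \<bar>x - y\<bar>" if "x \<le> y" for x y
  proof -
    have "0 \<le> max 0 x" "max 0 x \<le> max 0 y" "max 0 y - max 0 x \<le> y - x"
      using that by auto
    then show ?thesis
      using indemnitiesD(4,5)[OF assms, of "max 0 x" "max 0 y"] by linarith
  qed
  have le: "\<bar>I (max 0 x) - I (max 0 y)\<bar> \<le> \<bar>x - y\<bar>" for x y
    using mono[of x y] mono[of y x] by (cases "x \<le> y") (auto simp: abs_minus_commute)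
  show ?thesis
    unfolding continuous_on_iff dist_real_def using le by (meson le_less_trans)
qed

lemma measurable_indemnity:
  assumes "I \<in> indemnities" "Y \<in> borel_measurable M" "\<And>\<omega>. \<omega> \<in> space M \<Longrightarrow> 0 \<le> Y \<omega>"
  shows "(\<lambda>\<omega>. I (Y \<omega>)) \<in> borel_measurable M"
proof -
  have "(\<lambda>y. I (max 0 y)) \<in> borel_measurable borel"
    using continuous_on_indemnity_max[OF assms(1)] by (rule borel_measurable_continuous_onI)
  from measurable_compose[OF assms(2) this] show ?thesis
    by (rule measurable_cong[THEN iffD1, rotated]) (simp add: assms(3) max_def)
qed

text \<open>
  At a nonnegative level, the sublevel set of an indemnity on the half-line contains zero. By
  monotonicity and continuity it is a closed interval starting there, or everything.
\<close>

lemma indemnity_sublevel_cases: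
  assumes I: "I \<in> indemnities" and "0 \<le> z"
  obtains "\<And>y. 0 \<le> y \<Longrightarrow> I y \<le> z" | c where "\<And>y. 0 \<le> y \<Longrightarrow> I y \<le> z \<longleftrightarrow> y \<le> c"
proof (cases "\<forall>y\<ge>0. I y \<le> z")
  case True
  then show ?thesis
    using that(1) by blast
next
  case False
  then obtain b where b: "0 \<le> b" "z < I b"
    by auto
  define A where "A = {y. 0 \<le> y \<and> I y \<le> z}"
  have "A = {0..} \<inter> {y. I (max 0 y) \<le> z}"
    by (auto simp: A_def max_def)
  moreover have "closed {y. I (max 0 y) \<le> z}"
    using continuous_on_indemnity_max[OF I] by (intro closed_Collect_le) auto
  ultimately have "closed A"
    by auto
  moreover have "A \<noteq> {}"
    using assms indemnitiesD(1)[OF I] by (auto simp: A_def)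
  moreover have "bdd_above A"
  proof (rule bdd_aboveI[of _ b])
    fix y assume "y \<in> A"
    then show "y \<le> b"
      using indemnitiesD(4)[OF I b(1), of y] b(2)
      by (cases "b \<le> y") (auto simp: A_def)
  qed
  ultimately have "Sup A \<in> A" "\<And>y. y \<in> A \<Longrightarrow> y \<le> Sup A"
    using closed_contains_Sup cSup_upper by blast+
  then have "I y \<le> z \<longleftrightarrow> y \<le> Sup A" if "0 \<le> y" for y
    using that indemnitiesD(4)[OF I, of y "Sup A"] by (fastforce simp: A_def)
  then show ?thesis
    using that(2) by blast
qed

text \<open>
  The event that an indemnity is at most \<open>z\<close> is the event that the claim is at most some level,
  so a distortion of the claim's distribution function carries over to that of the indemnity.
\<close>

lemma cdf_indemnity_distorted:
  assumes P: "prob_space P" and Q: "prob_space Q"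
    and Y: "Y \<in> borel_measurable P" "Y \<in> borel_measurable Q"
    and pos: "\<And>\<omega>. \<omega> \<in> space P \<Longrightarrow> 0 \<le> Y \<omega>" "\<And>\<omega>. \<omega> \<in> space Q \<Longrightarrow> 0 \<le> Y \<omega>"
    and \<alpha>: "0 < \<alpha>" "\<alpha> < 1"
    and cdf: "\<And>y. cdf (distr Q borel Y) y = 1 - ES_distortion \<alpha> (1 - cdf (distr P borel Y) y)"
    and I: "I \<in> indemnities"
  shows "cdf (distr Q borel (\<lambda>\<omega>. I (Y \<omega>))) z
    = 1 - ES_distortion \<alpha> (1 - cdf (distr P borel (\<lambda>\<omega>. I (Y \<omega>))) z)"
proof (cases "0 \<le> z")
  case False
  then have "cdf (distr P borel (\<lambda>\<omega>. I (Y \<omega>))) z = 0" "cdf (distr Q borel (\<lambda>\<omega>. I (Y \<omega>))) z = 0"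
    using pos indemnitiesD(2)[OF I]
      cdf_distr_eq_0_of_nonneg[OF measurable_indemnity[OF I Y(1) pos(1)]]
      cdf_distr_eq_0_of_nonneg[OF measurable_indemnity[OF I Y(2) pos(2)]] by auto
  then show ?thesis
    using \<alpha> by (simp add: ES_distortion_eq_min)
next
  case True
  note law = cdf_distr_eq[OF measurable_indemnity[OF I Y(1) pos(1)], of z]
    cdf_distr_eq[OF measurable_indemnity[OF I Y(2) pos(2)], of z]
  from I True show ?thesis
  proof (cases rule: indemnity_sublevel_cases)
    case 1
    then have "{\<omega> \<in> space P. I (Y \<omega>) \<le> z} = space P" "{\<omega> \<in> space Q. I (Y \<omega>) \<le> z} = space Q"
      using pos by auto
    then show ?thesis
      using law \<alpha> prob_space.prob_space[OF P] prob_space.prob_space[OF Q]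
      by (simp add: ES_distortion_eq_min)
  next
    case (2 c)
    then have "{\<omega> \<in> space P. I (Y \<omega>) \<le> z} = {\<omega> \<in> space P. Y \<omega> \<le> c}"
      "{\<omega> \<in> space Q. I (Y \<omega>) \<le> z} = {\<omega> \<in> space Q. Y \<omega> \<le> c}"
      using pos by auto
    then show ?thesis
      using cdf[of c] by (simp add: law cdf_distr_eq Y)
  qed
qed

text \<open>
  When the claim has no atom at its quantile \<open>v\<close>, the event \<open>Y > v\<close> has probability exactly
  \<open>\<alpha>\<close>, and the distorted law is the law of the claim conditioned on that event.
\<close>

lemma expectation_distorted_eq_tail:
  assumes P: "prob_space P" and Q: "prob_space Q"
    and Y: "Y \<in> borel_measurable P" "Y \<in> borel_measurable Q"
    and pos: "\<And>\<omega>. \<omega> \<in> space P \<Longrightarrow> 0 \<le> Y \<omega>"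
    and \<alpha>: "0 < \<alpha>" "\<alpha> < 1"
    and cdf: "\<And>y. cdf (distr Q borel Y) y = 1 - ES_distortion \<alpha> (1 - cdf (distr P borel Y) y)"
    and cont: "isCont (cdf (distr P borel Y)) (VaR P \<alpha> Y)"
    and h: "h \<in> borel_measurable borel"
  shows "(\<integral>\<omega>. h (Y \<omega>) \<partial>Q) = 1 / \<alpha> * (\<integral>\<omega>. indicator {VaR P \<alpha> Y<..} (Y \<omega>) * h (Y \<omega>) \<partial>P)"
proof -
  interpret P: prob_space P by fact
  define v where "v = VaR P \<alpha> Y"
  define A where "A = {\<omega> \<in> space P. v < Y \<omega>}"
  let ?F = "cdf (distr P borel Y)"
  let ?U = "uniform_measure P A"
  note [measurable] = Y h
  have A [measurable]: "A \<in> sets P"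
    unfolding A_def by simp
  have Fv: "?F v = 1 - \<alpha>"
    unfolding v_def using \<alpha> by (intro cdf_VaR_eq P Y pos cont) auto
  have interval: "P.prob {\<omega> \<in> space P. v < Y \<omega> \<and> Y \<omega> \<le> y} = max (?F y - ?F v) 0" for y
  proof (cases "v \<le> y")
    case True
    have "{\<omega> \<in> space P. v < Y \<omega> \<and> Y \<omega> \<le> y}
        = {\<omega> \<in> space P. Y \<omega> \<le> y} - {\<omega> \<in> space P. Y \<omega> \<le> v}"
      by auto
    moreover have "P.prob ({\<omega> \<in> space P. Y \<omega> \<le> y} - {\<omega> \<in> space P. Y \<omega> \<le> v}) = ?F y - ?F v"
      using True by (subst P.finite_measure_Diff) (auto simp: cdf_distr_eq)
    moreover have "?F v \<le> ?F y"
      using True by (auto simp: cdf_distr_eq intro!: P.finite_measure_mono)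
    ultimately show ?thesis
      by simp
  next
    case False
    then have "{\<omega> \<in> space P. v < Y \<omega> \<and> Y \<omega> \<le> y} = {}"
      by auto
    moreover have "?F y \<le> ?F v"
      using False by (auto simp: cdf_distr_eq intro!: P.finite_measure_mono)
    ultimately show ?thesis
      by (simp only: measure_empty)
  qed
  have "A = space P - {\<omega> \<in> space P. Y \<omega> \<le> v}"
    by (auto simp: A_def)
  then have "P.prob A = \<alpha>"
    using Fv by (simp add: cdf_distr_eq P.prob_compl)
  then have emA: "emeasure P A = ennreal \<alpha>"
    by (simp add: P.emeasure_eq_measure)
  have U: "prob_space ?U"
    using emA \<alpha> by (intro prob_space_uniform_measure) auto
  have YU: "Y \<in> borel_measurable ?U"
    by simp
  have cdf_U: "cdf (distr ?U borel Y) y = cdf (distr Q borel Y) y" for y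
  proof -
    have "cdf (distr ?U borel Y) y = measure ?U {\<omega> \<in> space P. Y \<omega> \<le> y}"
      using cdf_distr_eq[OF YU, of y] by simp
    also have "\<dots> = P.prob (A \<inter> {\<omega> \<in> space P. Y \<omega> \<le> y}) / P.prob A"
      using emA \<alpha> by (subst measure_uniform_measure) auto
    also have "A \<inter> {\<omega> \<in> space P. Y \<omega> \<le> y} = {\<omega> \<in> space P. v < Y \<omega> \<and> Y \<omega> \<le> y}"
      by (auto simp: A_def)
    also have "P.prob \<dots> / P.prob A = max (?F y - (1 - \<alpha>)) 0 / \<alpha>"
      using interval Fv \<open>P.prob A = \<alpha>\<close> by simp
    also have "\<dots> = 1 - min ((1 - ?F y) / \<alpha>) 1"
      using \<alpha> by (auto simp: min_def max_def field_simps)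
    also have "\<dots> = 1 - ES_distortion \<alpha> (1 - ?F y)"
      using cdf_distr_in_01[OF P Y(1), of y] \<alpha> by (simp add: ES_distortion_eq_min)
    finally show ?thesis
      using cdf by simp
  qed
  have "distr Q borel Y = distr ?U borel Y"
    using cdf_U by (intro cdf_unique real_distribution_distr_borel Q U Y YU) auto
  then have "(\<integral>\<omega>. h (Y \<omega>) \<partial>Q) = (\<integral>\<omega>. h (Y \<omega>) \<partial>?U)"
    using integral_distr[OF Y(2) h] integral_distr[OF YU h] by simp
  also have "\<dots> = 1 / \<alpha> * (\<integral>\<omega>. indicator A \<omega> * h (Y \<omega>) \<partial>P)"
    using emA \<alpha> by (intro integral_uniform_measure) auto
  also have "(\<integral>\<omega>. indicator A \<omega> * h (Y \<omega>) \<partial>P)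
      = (\<integral>\<omega>. indicator {VaR P \<alpha> Y<..} (Y \<omega>) * h (Y \<omega>) \<partial>P)"
    by (intro Bochner_Integration.integral_cong) (auto simp: A_def v_def indicator_def)
  finally show ?thesis .
qed

text \<open>
  A law with a density charges no point, and atoms are the only jumps of a distribution function.
\<close>

lemma isCont_cdf_distributed:
  assumes "prob_space M" "distributed M lborel Y f"
  shows "isCont (cdf (distr M borel Y)) x"
proof -
  have Y: "Y \<in> borel_measurable M"
    using distributed_measurable[OF assms(2)] by simp
  interpret D: real_distribution "distr M borel Y"
    using assms(1) Y by (rule real_distribution_distr_borel)
  have "emeasure (distr M borel Y) {x} = emeasure (density lborel f) {x}"
    using distributed_distr_eq_density[OF assms(2)] distr_cong[of M M lborel borel Y Y] by simp
  moreover have "{x} \<in> null_sets lborel"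
    by (intro finite_imp_null_set_lborel) simp
  then have "{x} \<in> null_sets (density lborel f)"
    using absolutely_continuousI_density distributed_borel_measurable[OF assms(2)]
    unfolding absolutely_continuous_def by blast
  then have "emeasure (density lborel f) {x} = 0"
    by auto
  ultimately show ?thesis
    by (simp add: D.isCont_cdf measure_def)
qed

section \<open>Pointwise optimality of two layers\<close>

lemma two_layer_indemnity:
  assumes "0 \<le> a" "a \<le> b"
  shows "two_layer a b \<in> indemnities"
  using assms by (auto simp: two_layer_def indemnities_def min_def max_def)

text \<open>
  The retained loss \<open>R y = y - I y\<close> is again nonnegative and nondecreasing with slope at most
  one. Keep \<open>R v\<close> fixed, that is \<open>a = I v\<close>. Below \<open>v\<close> the cost increases in \<open>R\<close>, and the
  slope bound makes \<open>(y - a)\<^sub>+\<close> the least possible retention. Above \<open>v\<close> the cost is a parabola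
  in \<open>R\<close> with vertex \<open>m = (\<rho> - 1) / K\<close>; the retention \<open>min (y - a) m\<close>, or the
  constant \<open>R v\<close> if that is already past the vertex, is the feasible value closest to \<open>m\<close>.
\<close>

lemma two_layer_pointwise_optimal:
  fixes v K \<rho> y :: real
  assumes I: "I \<in> indemnities" and v: "0 \<le> v" and K: "0 < K" and y: "0 \<le> y"
  defines "a \<equiv> I v"
  defines "b \<equiv> max v (a + (\<rho> - 1) / K)"
  defines "cost \<equiv> \<lambda>i. \<rho> * (indicator {v<..} y * i) + (y - i) + K / 2 * (y - i)\<^sup>2"
  shows "cost (two_layer a b y) \<le> cost (I y)"
proof (cases "y \<le> v")
  case True
  have "two_layer a b y = min y a"
    using True by (simp add: two_layer_def b_def max_def)
  moreover have "I y \<le> min y a"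
    using indemnitiesD(3,4)[OF I] y True by (simp add: a_def)
  ultimately have "0 \<le> y - two_layer a b y" "y - two_layer a b y \<le> y - I y"
    by auto
  moreover from this have "(y - two_layer a b y)\<^sup>2 \<le> (y - I y)\<^sup>2"
    by (simp add: power_mono)
  ultimately show ?thesis
    using True K by (simp add: cost_def add_mono)
next
  case False
  define m where "m = (\<rho> - 1) / K"
  have lam: "\<rho> = 1 + K * m"
    using K by (simp add: m_def)
  \<comment> \<open>Completing the square: the cost above \<open>v\<close> depends on \<open>i\<close> only via the distance to \<open>m\<close>.\<close>
  have cost_eq: "cost i = \<rho> * y + K / 2 * (((y - i) - m)\<^sup>2 - m\<^sup>2)" for i
    using False by (simp add: cost_def lam power2_eq_square algebra_simps)
  have av: "a \<le> v"
    using indemnitiesD(3)[OF I v] by (simp add: a_def)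
  have I_bounds: "v - a \<le> y - I y" "y - I y \<le> y - a"
    using indemnitiesD(4,5)[OF I v, of y] False by (auto simp: a_def)
  have R: "y - two_layer a b y = min (y - a) (b - a)"
    using False av by (simp add: two_layer_def min_def max_def)
  have "\<bar>(y - two_layer a b y) - m\<bar> \<le> \<bar>(y - I y) - m\<bar>"
  proof (cases "m \<le> v - a")
    case True
    then have "b = v"
      by (simp add: b_def m_def)
    then show ?thesis
      using R True False I_bounds by auto
  next
    case below: False
    then have "b - a = m"
      by (simp add: b_def m_def)
    then show ?thesis
      using R I_bounds by auto
  qed
  then have "((y - two_layer a b y) - m)\<^sup>2 \<le> ((y - I y) - m)\<^sup>2"
    by (rule abs_le_square_iff[THEN iffD1])
  then show ?thesis
    using K by (simp add: cost_eq)
qed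

section \<open>Optimal layers\<close>

lemma continuous_on_integral_dominated:
  fixes h :: "'p::{first_countable_topology, t2_space} \<Rightarrow> 'a \<Rightarrow> real"
  assumes "integrable M w"
    and meas: "\<And>p. p \<in> S \<Longrightarrow> h p \<in> borel_measurable M"
    and cont: "\<And>x. x \<in> space M \<Longrightarrow> continuous_on S (\<lambda>p. h p x)"
    and bound: "\<And>p x. p \<in> S \<Longrightarrow> x \<in> space M \<Longrightarrow> \<bar>h p x\<bar> \<le> w x"
  shows "continuous_on S (\<lambda>p. \<integral>x. h p x \<partial>M)"
  unfolding continuous_on_sequentially comp_def
proof (intro allI ballI impI, elim conjE)
  fix u p assume p: "p \<in> S" and u: "\<forall>n. u n \<in> S" "u \<longlonglongrightarrow> p"
  show "(\<lambda>n. \<integral>x. h (u n) x \<partial>M) \<longlonglongrightarrow> (\<integral>x. h p x \<partial>M)"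
  proof (rule integral_dominated_convergence[where w = w])
    show "AE x in M. (\<lambda>n. h (u n) x) \<longlonglongrightarrow> h p x"
      using cont u p unfolding continuous_on_sequentially comp_def by auto
  qed (use assms(1) meas bound p u in auto)
qed

lemma continuous_on_hjb_objective_two_layer:
  assumes Y: "Y \<in> borel_measurable P" "Y \<in> borel_measurable Q"
    and pos: "\<And>\<omega>. \<omega> \<in> space P \<Longrightarrow> 0 \<le> Y \<omega>" "\<And>\<omega>. \<omega> \<in> space Q \<Longrightarrow> 0 \<le> Y \<omega>"
    and int: "integrable P Y" "integrable P (\<lambda>\<omega>. (Y \<omega>)\<^sup>2)" "integrable Q Y"
    and S: "S \<subseteq> {(a, b). 0 \<le> a \<and> a \<le> b}"
  shows "continuous_on S (\<lambda>p. hjb_objective P Q Y \<theta> \<gamma> r T t (two_layer (fst p) (snd p)))"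
proof -
  have cont: "continuous_on S (\<lambda>p. two_layer (fst p) (snd p) y)" for y
    unfolding two_layer_def by (intro continuous_intros)
  have ind: "two_layer (fst p) (snd p) \<in> indemnities" if "p \<in> S" for p
    using S that by (intro two_layer_indemnity) auto
  have meas: "(\<lambda>\<omega>. two_layer (fst p) (snd p) (Y \<omega>)) \<in> borel_measurable M"
    if "M = P \<or> M = Q" for p M
    using that Y unfolding two_layer_def by auto
  have bounds: "0 \<le> two_layer (fst p) (snd p) y" "two_layer (fst p) (snd p) y \<le> y"
    if "p \<in> S" "0 \<le> y" for p y
    using indemnitiesD(2,3)[OF ind] that by auto
  show ?thesis
    unfolding hjb_objective_def
  proof (intro continuous_on_add continuous_on_mult continuous_on_const)
    show "continuous_on S (\<lambda>p. \<integral>\<omega>. two_layer (fst p) (snd p) (Y \<omega>) \<partial>Q)"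
      using int(3) meas bounds pos(2) by (intro continuous_on_integral_dominated cont) auto
    show "continuous_on S (\<lambda>p. \<integral>\<omega>. Y \<omega> - two_layer (fst p) (snd p) (Y \<omega>) \<partial>P)"
      using int(1) meas bounds pos(1) Y
      by (intro continuous_on_integral_dominated[where w = Y] continuous_on_diff continuous_on_const
          cont borel_measurable_diff) auto
    show "continuous_on S (\<lambda>p. \<integral>\<omega>. (Y \<omega> - two_layer (fst p) (snd p) (Y \<omega>))\<^sup>2 \<partial>P)"
      using int(2) meas bounds pos(1) Y
      by (intro continuous_on_integral_dominated[where w = "\<lambda>\<omega>. (Y \<omega>)\<^sup>2"] continuous_on_diff
          continuous_on_power continuous_on_const cont borel_measurable_diff borel_measurable_power)
        (auto intro!: power_mono)
  qed
qed

lemma compact_layer_constraints: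
  fixes v c :: real
  shows "compact {(a, b). 0 \<le> a \<and> a \<le> v \<and> v \<le> b \<and> b \<le> max (a + c) v}" (is "compact ?S")
proof -
  have "?S = ({0..v} \<times> {v..max (v + c) v}) \<inter> {p. snd p \<le> max (fst p + c) v}"
    by auto
  moreover have "closed {p :: real \<times> real. snd p \<le> max (fst p + c) v}"
    by (intro closed_Collect_le continuous_intros)
  moreover have "compact ({0..v} \<times> {v..max (v + c) v})"
    by (intro compact_Times) auto
  ultimately show ?thesis
    by (simp add: compact_Int_closed)
qed

text \<open>
  The pointwise comparison, integrated. The layers are admissible because the upper one starts
  at \<open>v\<close> or \<open>(\<rho> - 1) / K\<close> beyond \<open>a\<close>, and \<open>(\<rho> - 1) / K\<close> is at most the distance \<open>\<rho> / K\<close>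
  allowed in the constraint.
\<close>

lemma two_layer_beats_indemnity:
  fixes v \<rho> :: real
  assumes Y: "Y \<in> borel_measurable P" and pos: "\<And>\<omega>. \<omega> \<in> space P \<Longrightarrow> 0 \<le> Y \<omega>"
    and int: "integrable P Y" "integrable P (\<lambda>\<omega>. (Y \<omega>)\<^sup>2)"
    and v: "0 \<le> v" and K: "0 < \<gamma> * exp (r * (T - t))"
    and premium: "\<And>J. J \<in> indemnities \<Longrightarrow> (1 + \<theta>) * (\<integral>\<omega>. J (Y \<omega>) \<partial>Q)
      = \<rho> * (\<integral>\<omega>. indicator {v<..} (Y \<omega>) * J (Y \<omega>) \<partial>P)"
    and I: "I \<in> indemnities"
  obtains a b where "0 \<le> a" "a \<le> v" "v \<le> b" "b \<le> max (a + \<rho> / (\<gamma> * exp (r * (T - t)))) v"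
    "hjb_objective P Q Y \<theta> \<gamma> r T t (two_layer a b) \<le> hjb_objective P Q Y \<theta> \<gamma> r T t I"
proof -
  define K where "K = \<gamma> * exp (r * (T - t))"
  have Kpos: "0 < K"
    using K by (simp add: K_def)
  define a where "a = I v"
  define b where "b = max v (a + (\<rho> - 1) / K)"
  let ?cost = "\<lambda>i y. \<rho> * (indicator {v<..} y * i) + (y - i) + K / 2 * (y - i)\<^sup>2"
  have ab: "0 \<le> a" "a \<le> v" "v \<le> b"
    using indemnitiesD(2,3)[OF I v] by (auto simp: a_def b_def)
  have "(\<rho> - 1) / K \<le> \<rho> / K"
    using Kpos by (simp add: divide_right_mono)
  then have "b \<le> max (a + \<rho> / K) v"
    by (auto simp: b_def max_def)
  have parts: "integrable P (\<lambda>\<omega>. indicator {v<..} (Y \<omega>) * J (Y \<omega>))"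
      "integrable P (\<lambda>\<omega>. Y \<omega> - J (Y \<omega>))" "integrable P (\<lambda>\<omega>. (Y \<omega> - J (Y \<omega>))\<^sup>2)"
    if J: "J \<in> indemnities" for J
  proof -
    note [measurable] = Y measurable_indemnity[OF J Y pos]
    have J_bounds: "0 \<le> J (Y \<omega>)" "J (Y \<omega>) \<le> Y \<omega>" if "\<omega> \<in> space P" for \<omega>
      using indemnitiesD(2,3)[OF J pos[OF that]] by auto
    show "integrable P (\<lambda>\<omega>. indicator {v<..} (Y \<omega>) * J (Y \<omega>))"
      by (rule Bochner_Integration.integrable_bound[OF int(1)])
        (use J_bounds pos in \<open>auto simp: indicator_def\<close>)
    show "integrable P (\<lambda>\<omega>. Y \<omega> - J (Y \<omega>))"
      by (rule Bochner_Integration.integrable_bound[OF int(1)]) (use J_bounds pos in auto)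
    show "integrable P (\<lambda>\<omega>. (Y \<omega> - J (Y \<omega>))\<^sup>2)"
      by (rule Bochner_Integration.integrable_bound[OF int(2)])
        (use J_bounds pos in \<open>auto intro!: power_mono\<close>)
  qed
  have cost: "integrable P (\<lambda>\<omega>. ?cost (J (Y \<omega>)) (Y \<omega>))"
      "hjb_objective P Q Y \<theta> \<gamma> r T t J = (\<integral>\<omega>. ?cost (J (Y \<omega>)) (Y \<omega>) \<partial>P)"
    if J: "J \<in> indemnities" for J
  proof -
    show "integrable P (\<lambda>\<omega>. ?cost (J (Y \<omega>)) (Y \<omega>))"
      using parts[OF J] by (intro Bochner_Integration.integrable_add integrable_mult_right)
    show "hjb_objective P Q Y \<theta> \<gamma> r T t J = (\<integral>\<omega>. ?cost (J (Y \<omega>)) (Y \<omega>) \<partial>P)"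
      using parts[OF J] premium[OF J] by (simp add: hjb_objective_def K_def)
  qed
  have "two_layer a b \<in> indemnities"
    using ab by (intro two_layer_indemnity) auto
  then have "hjb_objective P Q Y \<theta> \<gamma> r T t (two_layer a b)
      = (\<integral>\<omega>. ?cost (two_layer a b (Y \<omega>)) (Y \<omega>) \<partial>P)"
    by (rule cost(2))
  also have "\<dots> \<le> (\<integral>\<omega>. ?cost (I (Y \<omega>)) (Y \<omega>) \<partial>P)"
    using two_layer_pointwise_optimal[OF I v Kpos pos] \<open>two_layer a b \<in> indemnities\<close>
    by (intro integral_mono cost(1) I) (auto simp: a_def b_def)
  also have "\<dots> = hjb_objective P Q Y \<theta> \<gamma> r T t I"
    using I by (rule cost(2)[symmetric])
  finally show ?thesis
    using ab \<open>b \<le> max (a + \<rho> / K) v\<close> by (intro that[of a b]) (auto simp: K_def)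
qed

theorem proposition5:
  fixes P Q :: "'a measure" and Y :: "'a \<Rightarrow> real" and T r \<gamma> \<theta> \<alpha> :: real
  assumes "T > 0" and "r > 0" and "\<gamma> > 0" and "\<theta> \<ge> 0"
    and "0 < \<alpha>" and "\<alpha> < 1"
    and "prob_space P" and "prob_space Q" and "sets Q = sets P"
    and "Y \<in> borel_measurable P" and "\<forall>\<omega>\<in>space P. Y \<omega> > 0"
    and "integrable P Y" and "integrable P (\<lambda>\<omega>. (Y \<omega>)\<^sup>2)"
    and "integrable Q Y" and "integrable Q (\<lambda>\<omega>. (Y \<omega>)\<^sup>2)"
    and "\<exists>f. distributed P lborel Y f"
    and "finite {y. \<not> cdf (distr P borel Y) differentiable (at y)}"
    and "\<forall>y. cdf (distr Q borel Y) y = 1 - ES_distortion \<alpha> (1 - cdf (distr P borel Y) y)"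
  shows "(\<forall>I\<in>indemnities.
            (1 + \<theta>) * (\<integral>\<omega>. I (Y \<omega>) \<partial>Q) = (1 + \<theta>) * ES P \<alpha> (\<lambda>\<omega>. I (Y \<omega>))) \<and>
         (\<exists>a b. \<forall>t\<in>{0..T}. optimal_layers P Y \<alpha> \<theta> \<gamma> r T t (a t, b t)) \<and>
         (\<forall>a b. (\<forall>t\<in>{0..T}. optimal_layers P Y \<alpha> \<theta> \<gamma> r T t (a t, b t)) \<longrightarrow>
            optimal_indemnity P Q Y \<theta> \<gamma> r T (\<lambda>t. two_layer (a t) (b t)))"
proof -
  let ?H = "hjb_objective P Q Y \<theta> \<gamma> r T"
  define v where "v = VaR P \<alpha> Y"
  define lam where "lam = (1 + \<theta>) / \<alpha>"
  define c where "c t = (1 + \<theta>) / (\<alpha> * \<gamma> * exp (r * (T - t)))" for t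
  define S where "S t = {(a, b). 0 \<le> a \<and> a \<le> v \<and> v \<le> b \<and> b \<le> max (a + c t) v}" for t
  have c_eq: "lam / (\<gamma> * exp (r * (T - t))) = c t" for t
    by (simp add: lam_def c_def mult.assoc)
  have Y_Q: "Y \<in> borel_measurable Q"
    using assms(9,10) measurable_cong_sets[of Q P borel borel] by auto
  have pos: "0 \<le> Y \<omega>" if "\<omega> \<in> space P" for \<omega>
    using assms(11) that by force
  have pos_Q: "0 \<le> Y \<omega>" if "\<omega> \<in> space Q" for \<omega>
    using pos that sets_eq_imp_space_eq[OF assms(9)] by simp
  have cdf: "cdf (distr Q borel Y) y = 1 - ES_distortion \<alpha> (1 - cdf (distr P borel Y) y)" for y
    using assms(18) by blast
  have cont: "isCont (cdf (distr P borel Y)) v"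
    using assms(7,16) isCont_cdf_distributed by blast
  have v: "0 \<le> v"
    unfolding v_def using VaR_nonneg[OF assms(7,10,5)] .

  have ES: "(\<integral>\<omega>. I (Y \<omega>) \<partial>Q) = ES P \<alpha> (\<lambda>\<omega>. I (Y \<omega>))" if I: "I \<in> indemnities" for I
  proof (rule expectation_distorted_eq_ES)
    show "cdf (distr Q borel (\<lambda>\<omega>. I (Y \<omega>))) z
        = 1 - ES_distortion \<alpha> (1 - cdf (distr P borel (\<lambda>\<omega>. I (Y \<omega>))) z)" for z
      by (rule cdf_indemnity_distorted[OF assms(7,8,10) Y_Q pos pos_Q assms(5,6) cdf I])
    show "(\<lambda>\<omega>. I (Y \<omega>)) \<in> borel_measurable P" "(\<lambda>\<omega>. I (Y \<omega>)) \<in> borel_measurable Q"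
      using measurable_indemnity[OF I assms(10) pos] measurable_indemnity[OF I Y_Q pos_Q] by simp_all
  qed (use assms(5-8) pos indemnitiesD(2)[OF I] in auto)
  then have objective_eq: "ES_objective P Y \<alpha> \<theta> \<gamma> r T t I = ?H t I" if "I \<in> indemnities" for t I
    using that by (simp add: ES_objective_def hjb_objective_def)

  have premium: "(1 + \<theta>) * (\<integral>\<omega>. J (Y \<omega>) \<partial>Q)
      = lam * (\<integral>\<omega>. indicator {v<..} (Y \<omega>) * J (Y \<omega>) \<partial>P)" if J: "J \<in> indemnities" for J
  proof -
    \<comment> \<open>\<open>J\<close> is arbitrary at negative arguments and need not be Borel on the whole line.\<close>
    have "(\<lambda>y. J (max 0 y)) \<in> borel_measurable borel"
      using continuous_on_indemnity_max[OF J] by (rule borel_measurable_continuous_onI)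
    then have "(\<integral>\<omega>. J (max 0 (Y \<omega>)) \<partial>Q)
        = 1 / \<alpha> * (\<integral>\<omega>. indicator {v<..} (Y \<omega>) * J (max 0 (Y \<omega>)) \<partial>P)"
      unfolding v_def using assms(5-8,10) Y_Q pos cdf cont
      by (intro expectation_distorted_eq_tail[where h = "\<lambda>y. J (max 0 y)"]) (auto simp: v_def)
    also have "(\<integral>\<omega>. J (max 0 (Y \<omega>)) \<partial>Q) = (\<integral>\<omega>. J (Y \<omega>) \<partial>Q)"
      using pos_Q by (intro Bochner_Integration.integral_cong) (auto simp: max_def)
    also have "(\<integral>\<omega>. indicator {v<..} (Y \<omega>) * J (max 0 (Y \<omega>)) \<partial>P)
        = (\<integral>\<omega>. indicator {v<..} (Y \<omega>) * J (Y \<omega>) \<partial>P)"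
      using pos by (intro Bochner_Integration.integral_cong) (auto simp: max_def)
    finally show ?thesis
      by (simp add: lam_def)
  qed

  have feasible: "two_layer (fst p) (snd p) \<in> indemnities" if "p \<in> S t" for p t
    using that by (intro two_layer_indemnity) (auto simp: S_def)
  \<comment> \<open>On admissible layers the two objectives agree, so both problems share one functional.\<close>
  have layers_iff: "optimal_layers P Y \<alpha> \<theta> \<gamma> r T t p \<longleftrightarrow>
      p \<in> S t \<and> (\<forall>q\<in>S t. ?H t (two_layer (fst p) (snd p)) \<le> ?H t (two_layer (fst q) (snd q)))"
    for t p
    unfolding optimal_layers_def is_arg_min_linorder
    using feasible[of _ t] by (auto simp: S_def v_def c_def objective_eq split: prod.splits)

  have "\<exists>p. optimal_layers P Y \<alpha> \<theta> \<gamma> r T t p" for t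
  proof -
    have "compact (S t)"
      unfolding S_def by (rule compact_layer_constraints)
    moreover have "(0, v) \<in> S t"
      using v by (simp add: S_def)
    moreover have "continuous_on (S t) (\<lambda>p. ?H t (two_layer (fst p) (snd p)))"
      by (rule continuous_on_hjb_objective_two_layer[OF assms(10) Y_Q pos pos_Q assms(12-14)])
        (auto simp: S_def)
    ultimately show ?thesis
      using continuous_attains_inf[of "S t"] layers_iff by blast
  qed
  then obtain p where "\<And>t. optimal_layers P Y \<alpha> \<theta> \<gamma> r T t (p t)"
    by metis
  then have exist: "\<exists>a b. \<forall>t\<in>{0..T}. optimal_layers P Y \<alpha> \<theta> \<gamma> r T t (a t, b t)"
    by (intro exI[of _ "\<lambda>t. fst (p t)"] exI[of _ "\<lambda>t. snd (p t)"]) simp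

  have optimal: "is_arg_min (?H t) (\<lambda>I. I \<in> indemnities) (two_layer a b)"
    if opt: "optimal_layers P Y \<alpha> \<theta> \<gamma> r T t (a, b)" for a b t
    unfolding is_arg_min_linorder
  proof (intro conjI allI impI)
    show "two_layer a b \<in> indemnities"
      using opt feasible[of "(a, b)" t] by (simp add: layers_iff)
  next
    fix I :: "real \<Rightarrow> real" assume I: "I \<in> indemnities"
    have K: "0 < \<gamma> * exp (r * (T - t))"
      using assms(3) by simp
    obtain a' b' where "(a', b') \<in> S t" "?H t (two_layer a' b') \<le> ?H t I"
      by (rule two_layer_beats_indemnity[OF assms(10) pos assms(12,13) v K premium I])
        (auto simp: S_def c_eq)
    then show "?H t (two_layer a b) \<le> ?H t I"
      using opt by (force simp: layers_iff)
  qed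

  show ?thesis
    using ES exist optimal by (simp add: optimal_indemnity_def)
qed

end
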